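(* Assume that $(Q_{r,s})$ is such that there exist $u,v>0$ with $(u,v)\in\mathcal E$. Let $\rho_0,\sigma_0>0$ be fixed. Then there is exactly one pair $(z,w)\in\mathcal E$ with $z,w>0$ such that $$\ln\Big(\frac zu\Big)\big(\rho_0-\rho(\bar c^{z,w})\big)+\ln\Big(\frac wv\Big)\big(\sigma_0-\sigma(\bar c^{z,w})\big)\ge0\quad\text{for all } u,v>0\text{ with }(u,v)\in\mathcal E,$$ and for every sequence $\Gamma_n\to\Omega$ we have $z^{\Gamma_n}\to z$ and $w^{\Gamma_n}\to w$ as $n\to\infty$, where $(z^{\Gamma_n},w^{\Gamma_n})$ is the pair determined by $\Gamma_n$ and the masses $\rho_0,\sigma_0$.
   Context: $\Omega=\{(r,s)\in\mathbb N_0^2 : r+s\ge1\}$, and $Q_{r,s}>0$, $(r,s)\in\Omega$, are given positive numbers with $Q_{1,0}=Q_{0,1}=1$. For $z,w\ge0$ let $\bar c^{z,w}_{r,s}=z^rw^sQ_{r,s}$ (with $0^0=1$). For a nonnegative sequence $c$ on $\Omega$, $\rho(c)=\sum_{(r,s)\in\Omega}r\,c_{r,s}$ and $\sigma(c)=\sum_{(r,s)\in\Omega}s\,c_{r,s}$. The region of existence is $\mathcal E=\{(z,w): z\ge0,\ w\ge0,\ \rho(\bar c^{z,w})+\sigma(\bar c^{z,w})<\infty\}$. For a finite set $\Gamma\subset\Omega$ with $(1,0),(0,1)\in\Gamma$, the pair $z^\Gamma,w^\Gamma\ge0$ denotes the unique pair with $\sum_{(r,s)\in\Gamma}r\,(z^\Gamma)^r(w^\Gamma)^sQ_{r,s}=\rho_0$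 and $\sum_{(r,s)\in\Gamma}s\,(z^\Gamma)^r(w^\Gamma)^sQ_{r,s}=\sigma_0$ (existence and uniqueness are known). For a sequence $(\Gamma_n)$ of such finite sets, $\Gamma_n\to\Omega$ means that for every $(r,s)\in\Omega$ there is $M\in\mathbb N$ with $(r,s)\in\Gamma_n$ for all $n\ge M$. *)

theory Defs
  imports "HOL-Analysis.Analysis"
begin

definition Omega :: "(nat \<times> nat) set" where
  "Omega = {(r, s). r + s \<ge> 1}"

definition cbar :: "(nat \<times> nat \<Rightarrow> real) \<Rightarrow> real \<Rightarrow> real \<Rightarrow> nat \<times> nat \<Rightarrow> real" where
  "cbar Q z w = (\<lambda>(r, s). z ^ r * w ^ s * Q (r, s))"

text \<open>The two masses of a nonnegative sequence on \<open>Omega\<close> take values in \<open>[0, \<infinity>]\<close>; sums of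
  \<^typ>\<open>ennreal\<close> always exist, so no summability assumption is hidden here. The function
  \<^const>\<open>ennreal\<close> sends negative reals to \<open>0\<close>, so the definitions are meaningful only for
  sequences that are nonnegative on \<open>Omega\<close>.\<close>

definition rho :: "(nat \<times> nat \<Rightarrow> real) \<Rightarrow> ennreal" where
  "rho c = (\<Sum>\<^sub>\<infinity>(r, s)\<in>Omega. ennreal (real r * c (r, s)))"

definition sigma :: "(nat \<times> nat \<Rightarrow> real) \<Rightarrow> ennreal" where
  "sigma c = (\<Sum>\<^sub>\<infinity>(r, s)\<in>Omega. ennreal (real s * c (r, s)))"

definition existence_region :: "(nat \<times> nat \<Rightarrow> real) \<Rightarrow> (real \<times> real) set" where
  "existence_region Q =
     {(z, w). z \<ge> 0 \<and> w \<ge> 0 \<and> rho (cbar Q z w) + sigma (cbar Q z w) < \<infinity>}"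

definition admissible :: "(nat \<times> nat) set \<Rightarrow> bool" where
  "admissible \<Gamma> \<longleftrightarrow> finite \<Gamma> \<and> \<Gamma> \<subseteq> Omega \<and> (1, 0) \<in> \<Gamma> \<and> (0, 1) \<in> \<Gamma>"

text \<open>For admissible \<open>\<Gamma>\<close> and positive \<open>\<rho>\<^sub>0\<close>, \<open>\<sigma>\<^sub>0\<close> there is exactly one pair as described below.\<close>

definition truncated_pair ::
    "(nat \<times> nat \<Rightarrow> real) \<Rightarrow> real \<Rightarrow> real \<Rightarrow> (nat \<times> nat) set \<Rightarrow> real \<times> real" where
  "truncated_pair Q \<rho>\<^sub>0 \<sigma>\<^sub>0 \<Gamma> = (THE (z, w). z \<ge> 0 \<and> w \<ge> 0 \<and>
     (\<Sum>(r, s)\<in>\<Gamma>. real r * z ^ r * w ^ s * Q (r, s)) = \<rho>\<^sub>0 \<and>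
     (\<Sum>(r, s)\<in>\<Gamma>. real s * z ^ r * w ^ s * Q (r, s)) = \<sigma>\<^sub>0)"

definition tends_to_Omega :: "(nat \<Rightarrow> (nat \<times> nat) set) \<Rightarrow> bool" where
  "tends_to_Omega \<Gamma> \<longleftrightarrow> (\<forall>p\<in>Omega. \<exists>M. \<forall>n\<ge>M. p \<in> \<Gamma> n)"

text \<open>Both masses are finite on \<^const>\<open>existence_region\<close>, so \<^const>\<open>enn2real\<close> loses nothing here.\<close>

definition variational_pair ::
    "(nat \<times> nat \<Rightarrow> real) \<Rightarrow> real \<Rightarrow> real \<Rightarrow> real \<Rightarrow> real \<Rightarrow> bool" where
  "variational_pair Q \<rho>\<^sub>0 \<sigma>\<^sub>0 z w \<longleftrightarrow>
     (z, w) \<in> existence_region Q \<and> z > 0 \<and> w > 0 \<and>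
     (\<forall>u v. u > 0 \<and> v > 0 \<and> (u, v) \<in> existence_region Q \<longrightarrow>
        ln (z / u) * (\<rho>\<^sub>0 - enn2real (rho (cbar Q z w)))
        + ln (w / v) * (\<sigma>\<^sub>0 - enn2real (sigma (cbar Q z w))) \<ge> 0)"

end

(* In the coordinates x = ln z, y = ln w the function
     G(x, y) = (sum of Q_{r,s} exp(r x + s y)) - rho_0 x - sigma_0 y
   is strictly convex and coercive, because it contains exp x + exp y, and it is lower
   semicontinuous with values in (-infinity, infinity]. Hence it has exactly one minimiser. Moving a
   minimiser in the direction (-1, -1) shows that its masses are finite, and the one-sided
   derivatives of G there are precisely the variational inequality. By strict monotonicity of the
   gradient that inequality has at most one solution. For finite Gamma it says that the gradient of
   the truncated function vanishes, which gives the pair determined by Gamma. The truncated functions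
   increase to G, so every limit point of their minimisers minimises G, and by coercivity they
   converge. *)

theory Submission imports Defs
begin

section \<open>Infinite sums of reals and of extended nonnegative reals\<close>

lemma infsum_minus:
  fixes f g :: "'a \<Rightarrow> real"
  assumes "f summable_on A" "g summable_on A"
  shows "(\<lambda>x. f x - g x) summable_on A"
    and "(\<Sum>\<^sub>\<infinity>x\<in>A. f x - g x) = infsum f A - infsum g A"
  using summable_on_add[OF assms(1), of "\<lambda>x. - g x"] infsum_add[OF assms(1), of "\<lambda>x. - g x"] assms(2)
  by (simp_all add: summable_on_uminus infsum_uminus)

lemma infsum_split_finite:
  fixes f :: "'a \<Rightarrow> real"
  assumes "f summable_on A" "finite F" "F \<subseteq> A"
  shows "infsum f A = sum f F + infsum f (A - F)"
proof -
  have "f summable_on (A - F)" using assms(1) by (rule summable_on_subset_banach) auto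
  moreover have "F \<union> (A - F) = A" using assms(3) by auto
  ultimately show ?thesis
    using infsum_Un_disjoint[of f F "A - F"] assms(2) by auto
qed

lemma infsum_ennreal_eq:
  fixes f :: "'a \<Rightarrow> real"
  assumes "f summable_on A" "\<And>x. x \<in> A \<Longrightarrow> f x \<ge> 0"
  shows "(\<Sum>\<^sub>\<infinity>x\<in>A. ennreal (f x)) = ennreal (infsum f A)"
proof -
  have "(\<Sum>\<^sub>\<infinity>x\<in>A. ennreal (f x)) = (SUP F\<in>{F. finite F \<and> F \<subseteq> A}. (\<Sum>x\<in>F. ennreal (f x)))"
    by (rule nonneg_infsum_complete) simp
  also have "\<dots> = (SUP F\<in>{F. finite F \<and> F \<subseteq> A}. ennreal (sum f F))"
    by (intro SUP_cong refl sum_ennreal) (use assms in auto)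
  finally show ?thesis
    by (simp add: infsum_nonneg_is_SUPREMUM_ennreal[OF assms])
qed

lemma summable_on_if_infsum_ennreal_finite:
  fixes f :: "'a \<Rightarrow> real"
  assumes fin: "(\<Sum>\<^sub>\<infinity>x\<in>A. ennreal (f x)) < \<infinity>" and nn: "\<And>x. x \<in> A \<Longrightarrow> f x \<ge> 0"
  shows "f summable_on A"
proof (rule nonneg_bdd_above_summable_on[OF nn])
  show "bdd_above (sum f ` {F. F \<subseteq> A \<and> finite F})"
  proof (rule bdd_aboveI2)
    fix F assume F: "F \<in> {F. F \<subseteq> A \<and> finite F}"
    have "ennreal (sum f F) = (\<Sum>x\<in>F. ennreal (f x))"
      by (rule sum_ennreal[symmetric]) (use F nn in auto)
    also have "\<dots> \<le> (SUP F\<in>{F. finite F \<and> F \<subseteq> A}. (\<Sum>x\<in>F. ennreal (f x)))"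
      by (rule SUP_upper) (use F in auto)
    also have "\<dots> = (\<Sum>\<^sub>\<infinity>x\<in>A. ennreal (f x))"
      by (rule nonneg_infsum_complete[symmetric]) simp
    \<comment> \<open>\<open>enn2real\<close> sends infinity to 0, so this monotonicity step rests
      on the finiteness of the full sum.\<close>
    finally have "enn2real (ennreal (sum f F)) \<le> enn2real (\<Sum>\<^sub>\<infinity>x\<in>A. ennreal (f x))"
      by (rule enn2real_mono) (use fin in simp)
    moreover have "sum f F \<ge> 0" using F nn by (auto intro: sum_nonneg)
    ultimately show "sum f F \<le> enn2real (\<Sum>\<^sub>\<infinity>x\<in>A. ennreal (f x))" by simp
  qed
qed

section \<open>Two inequalities for the exponential function\<close>

text \<open>The tangent to exp at ln (a + 1) has slope a + 1, which leaves slope 1 for positive x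
  once a * x is subtracted. For negative x the linear term alone grows with rate a.\<close>

lemma exp_minus_linear_coercive:
  fixes a :: real
  assumes "a > 0"
  obtains c where "\<And>x. exp x - a * x \<ge> min 1 a * \<bar>x\<bar> - c"
proof
  define l where "l = a + 1"
  fix x :: real
  have l: "l > 0" using assms by (simp add: l_def)
  have "exp (x - ln l) \<ge> 1 + (x - ln l)" by (rule exp_ge_add_one_self)
  then have "l * exp (x - ln l) \<ge> l * (1 + (x - ln l))"
    using l by (intro mult_left_mono) auto
  moreover have "l * exp (x - ln l) = exp x"
    using l by (simp add: exp_diff)
  ultimately have *: "exp x - a * x \<ge> x + l - l * ln l"
    by (simp add: l_def algebra_simps)
  \<comment> \<open>The absolute value keeps the subtracted constant nonnegative, so that one
    constant serves both signs of x.\<close>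
  show "exp x - a * x \<ge> min 1 a * \<bar>x\<bar> - \<bar>l - l * ln l\<bar>"
  proof (cases "x \<ge> 0")
    case True
    then have "min 1 a * \<bar>x\<bar> \<le> 1 * \<bar>x\<bar>" by (intro mult_right_mono) auto
    with * True show ?thesis by linarith
  next
    case False
    then have "min 1 a * \<bar>x\<bar> \<le> a * \<bar>x\<bar>" by (intro mult_right_mono) auto
    also have "\<dots> = - (a * x)" using False by (simp add: abs_if)
    finally show ?thesis using exp_gt_zero[of x] by linarith
  qed
qed

text \<open>By convexity the graph over [0, 1] lies below its chord; difference quotients at 0 are
  therefore bounded by their value at t = 1.\<close>

lemma exp_scaled_minus_one_le:
  fixes c t :: real
  assumes "0 \<le> t" "t \<le> 1"
  shows "exp (t * c) - 1 \<le> t * (exp c - 1)"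
  using convex_onD[OF exp_convex, of t 0 c] assms by (simp add: algebra_simps)

section \<open>The existence region in terms of real summability\<close>

text \<open>Replaces the extended masses by real sums. All terms are nonnegative, so finiteness of
  an extended sum and summability of the real family coincide.\<close>

lemma existence_region_iff:
  fixes Q :: "nat \<times> nat \<Rightarrow> real"
  assumes "\<And>i. i \<in> Omega \<Longrightarrow> Q i > 0" "z > 0" "w > 0"
  shows "(z, w) \<in> existence_region Q \<longleftrightarrow>
    (\<lambda>i. cbar Q z w i * real (fst i)) summable_on Omega \<and>
    (\<lambda>i. cbar Q z w i * real (snd i)) summable_on Omega"
    and "(\<lambda>i. cbar Q z w i * real (fst i)) summable_on Omega \<Longrightarrow>
      enn2real (rho (cbar Q z w)) = (\<Sum>\<^sub>\<infinity>i\<in>Omega. cbar Q z w i * real (fst i))"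
    and "(\<lambda>i. cbar Q z w i * real (snd i)) summable_on Omega \<Longrightarrow>
      enn2real (sigma (cbar Q z w)) = (\<Sum>\<^sub>\<infinity>i\<in>Omega. cbar Q z w i * real (snd i))"
proof -
  let ?r = "\<lambda>i. cbar Q z w i * real (fst i)" and ?s = "\<lambda>i. cbar Q z w i * real (snd i)"
  have r: "rho (cbar Q z w) = (\<Sum>\<^sub>\<infinity>i\<in>Omega. ennreal (?r i))"
    unfolding rho_def by (intro infsum_cong) (auto simp: mult.commute)
  have s: "sigma (cbar Q z w) = (\<Sum>\<^sub>\<infinity>i\<in>Omega. ennreal (?s i))"
    unfolding sigma_def by (intro infsum_cong) (auto simp: mult.commute)
  have nn: "?r i \<ge> 0" "?s i \<ge> 0" if "i \<in> Omega" for i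
    using assms(1)[OF that] assms(2,3) by (auto simp: cbar_def case_prod_beta intro!: mult_nonneg_nonneg)
  have re: "rho (cbar Q z w) = ennreal (infsum ?r Omega)" if "?r summable_on Omega"
    unfolding r by (rule infsum_ennreal_eq[OF that nn(1)])
  have se: "sigma (cbar Q z w) = ennreal (infsum ?s Omega)" if "?s summable_on Omega"
    unfolding s by (rule infsum_ennreal_eq[OF that nn(2)])
  show "(z, w) \<in> existence_region Q \<longleftrightarrow> ?r summable_on Omega \<and> ?s summable_on Omega"
  proof
    assume "(z, w) \<in> existence_region Q"
    then have "rho (cbar Q z w) < \<infinity>" "sigma (cbar Q z w) < \<infinity>"
      by (auto simp: existence_region_def)
    then show "?r summable_on Omega \<and> ?s summable_on Omega"
      using summable_on_if_infsum_ennreal_finite[of ?r Omega]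
        summable_on_if_infsum_ennreal_finite[of ?s Omega] nn by (simp add: r s)
  next
    assume "?r summable_on Omega \<and> ?s summable_on Omega"
    then show "(z, w) \<in> existence_region Q"
      using assms by (simp add: existence_region_def re se)
  qed
  show "enn2real (rho (cbar Q z w)) = infsum ?r Omega" if "?r summable_on Omega"
    using re[OF that] infsum_nonneg[of Omega ?r] nn by simp
  show "enn2real (sigma (cbar Q z w)) = infsum ?s Omega" if "?s summable_on Omega"
    using se[OF that] infsum_nonneg[of Omega ?s] nn by simp
qed

section \<open>The energy in logarithmic coordinates\<close>

text \<open>The exponent (r, s) as a real vector, so that z ^ r * w ^ s becomes exp of its inner
  product with (ln z, ln w).\<close>

definition kvec :: "nat \<times> nat \<Rightarrow> real \<times> real" where
  "kvec i = (real (fst i), real (snd i))"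

lemma inner_kvec: "kvec i \<bullet> p = real (fst i) * fst p + real (snd i) * snd p"
  by (cases p) (simp add: kvec_def)

locale cluster_weights =
  fixes Q :: "nat \<times> nat \<Rightarrow> real" and \<nu> :: "real \<times> real"
  assumes Q_pos: "i \<in> Omega \<Longrightarrow> Q i > 0"
    and Q10: "Q (1, 0) = 1" and Q01: "Q (0, 1) = 1"
    and \<nu>_pos: "fst \<nu> > 0" "snd \<nu> > 0"
begin

text \<open>Here \<open>p = (ln z, ln w)\<close> and \<open>\<nu> = (\<rho>\<^sub>0, \<sigma>\<^sub>0)\<close>. Divergent sums \<^const>\<open>infsum\<close> are \<open>0\<close>, so
  \<open>energy\<close> is meaningful only on \<open>dom\<close>, and \<open>grad\<close> only on \<open>mass_dom\<close>.
  Note that \<open>grad \<Gamma> p d\<close> omits the contribution \<open>- \<nu> \<bullet> d\<close> of the linear part of \<open>energy\<close>.\<close>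

definition dens :: "real \<times> real \<Rightarrow> nat \<times> nat \<Rightarrow> real" where
  "dens p i = Q i * exp (kvec i \<bullet> p)"

definition dom :: "(nat \<times> nat) set \<Rightarrow> (real \<times> real) set" where
  "dom \<Gamma> = {p. dens p summable_on \<Gamma>}"

definition energy :: "(nat \<times> nat) set \<Rightarrow> real \<times> real \<Rightarrow> real" where
  "energy \<Gamma> p = infsum (dens p) \<Gamma> - \<nu> \<bullet> p"

definition mass_dom :: "(nat \<times> nat) set \<Rightarrow> (real \<times> real) set" where
  "mass_dom \<Gamma> = {p. (\<lambda>i. dens p i * (kvec i \<bullet> (1, 1))) summable_on \<Gamma>}"

definition grad :: "(nat \<times> nat) set \<Rightarrow> real \<times> real \<Rightarrow> real \<times> real \<Rightarrow> real" where
  "grad \<Gamma> p d = (\<Sum>\<^sub>\<infinity>i\<in>\<Gamma>. dens p i * (kvec i \<bullet> d))"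

text \<open>Competitors are restricted to \<open>dom\<close>: outside it the default value 0 of the
  sum would make \<open>energy\<close> spuriously small where its true value is infinite.\<close>

definition minimiser :: "(nat \<times> nat) set \<Rightarrow> real \<times> real \<Rightarrow> bool" where
  "minimiser \<Gamma> p \<longleftrightarrow> p \<in> dom \<Gamma> \<and> (\<forall>q\<in>dom \<Gamma>. energy \<Gamma> p \<le> energy \<Gamma> q)"

text \<open>Finiteness is not demanded, so truncations and \<open>Omega\<close> itself are treated
  alike. The two monomers give coercivity and strict monotonicity.\<close>

definition has_monomers :: "(nat \<times> nat) set \<Rightarrow> bool" where
  "has_monomers \<Gamma> \<longleftrightarrow> \<Gamma> \<subseteq> Omega \<and> (1, 0) \<in> \<Gamma> \<and> (0, 1) \<in> \<Gamma>"

lemma dens_nonneg: "i \<in> Omega \<Longrightarrow> dens p i \<ge> 0"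
  and dens_pos: "i \<in> Omega \<Longrightarrow> dens p i > 0"
  using Q_pos[of i] by (auto simp: dens_def)

lemma dens_unit: "dens p (1, 0) = exp (fst p)" "dens p (0, 1) = exp (snd p)"
  by (simp_all add: dens_def inner_kvec Q10[simplified] Q01[simplified])

lemma dens_add: "dens (p + d) i = dens p i * exp (kvec i \<bullet> d)"
  by (simp add: dens_def inner_add_right exp_add)

lemma energy_finite: "finite A \<Longrightarrow> energy A p = sum (dens p) A - \<nu> \<bullet> p"
  by (simp add: energy_def)

lemma dom_finite: "finite A \<Longrightarrow> dom A = UNIV"
  by (simp add: dom_def)

lemma continuous_energy_finite: "finite A \<Longrightarrow> continuous_on UNIV (energy A)"
  unfolding energy_def dens_def by simp (intro continuous_intros)

lemma energy_mono_finite: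
  assumes "finite A" "A \<subseteq> \<Gamma>" "\<Gamma> \<subseteq> Omega" "p \<in> dom \<Gamma>"
  shows "energy A p \<le> energy \<Gamma> p"
proof -
  have "sum (dens p) A \<le> infsum (dens p) \<Gamma>"
    by (rule finite_sum_le_infsum) (use assms in \<open>auto simp: dom_def intro!: dens_nonneg\<close>)
  then show ?thesis using assms by (simp add: energy_def)
qed

text \<open>All terms are nonnegative, so the energy is the supremum of its finite truncations. This
  takes the place of lower semicontinuity, and it also yields membership in the domain.\<close>

lemma energy_le_if_finite:
  assumes \<Gamma>: "\<Gamma> \<subseteq> Omega" and le: "\<And>A. finite A \<Longrightarrow> A \<subseteq> \<Gamma> \<Longrightarrow> energy A p \<le> c"
  shows "p \<in> dom \<Gamma>" "energy \<Gamma> p \<le> c"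
proof -
  have le': "sum (dens p) A \<le> c + \<nu> \<bullet> p" if "finite A" "A \<subseteq> \<Gamma>" for A
    using le[OF that] that by (simp add: energy_finite)
  show dom: "p \<in> dom \<Gamma>" unfolding dom_def mem_Collect_eq
  proof (rule nonneg_bdd_above_summable_on)
    show "bdd_above (sum (dens p) ` {F. F \<subseteq> \<Gamma> \<and> finite F})"
      by (rule bdd_aboveI2[where M = "c + \<nu> \<bullet> p"]) (use le' in auto)
  qed (use \<Gamma> in \<open>auto intro!: dens_nonneg\<close>)
  have "infsum (dens p) \<Gamma> \<le> c + \<nu> \<bullet> p"
    by (rule infsum_le_finite_sums) (use dom le' in \<open>auto simp: dom_def\<close>)
  then show "energy \<Gamma> p \<le> c" by (simp add: energy_def)
qed

section \<open>Coercivity and existence of minimisers\<close>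

text \<open>The two monomers alone contribute exp x + exp y, so the variables separate and each is
  controlled by the one-dimensional bound.\<close>

lemma energy_coercive: "bounded {p. energy {(1, 0), (0, 1)} p \<le> C}"
proof -
  obtain c1 where c1: "\<And>x. exp x - fst \<nu> * x \<ge> min 1 (fst \<nu>) * \<bar>x\<bar> - c1"
    using exp_minus_linear_coercive \<nu>_pos by metis
  obtain c2 where c2: "\<And>x. exp x - snd \<nu> * x \<ge> min 1 (snd \<nu>) * \<bar>x\<bar> - c2"
    using exp_minus_linear_coercive \<nu>_pos by metis
  define m where "m = min 1 (min (fst \<nu>) (snd \<nu>))"
  have m: "m > 0" using \<nu>_pos by (simp add: m_def)
  show ?thesis
  proof (rule boundedI)
    fix p assume "p \<in> {p. energy {(1, 0), (0, 1)} p \<le> C}"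
    then have "exp (fst p) + exp (snd p) - (fst \<nu> * fst p + snd \<nu> * snd p) \<le> C"
      by (simp add: energy_finite dens_unit[simplified] inner_prod_def)
    moreover have "m * \<bar>fst p\<bar> \<le> min 1 (fst \<nu>) * \<bar>fst p\<bar>" "m * \<bar>snd p\<bar> \<le> min 1 (snd \<nu>) * \<bar>snd p\<bar>"
      by (auto intro!: mult_right_mono simp: m_def)
    ultimately have "m * (\<bar>fst p\<bar> + \<bar>snd p\<bar>) \<le> C + c1 + c2"
      using c1[of "fst p"] c2[of "snd p"] by (simp add: distrib_left)
    then have "\<bar>fst p\<bar> + \<bar>snd p\<bar> \<le> (C + c1 + c2) / m"
      using m by (simp add: pos_le_divide_eq mult.commute)
    moreover have "norm p \<le> \<bar>fst p\<bar> + \<bar>snd p\<bar>"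
      using norm_Pair_le[of "fst p" "snd p"] by simp
    ultimately show "norm p \<le> (C + c1 + c2) / m" by linarith
  qed
qed

text \<open>Coercivity together with Fatou's lemma, stated through the finite partial sums.\<close>

lemma compactness_of_almost_minimisers:
  assumes \<Gamma>: "has_monomers \<Gamma>"
    and ev: "\<And>A e. finite A \<Longrightarrow> A \<subseteq> \<Gamma> \<Longrightarrow> e > 0 \<Longrightarrow> eventually (\<lambda>n. energy A (p n) \<le> c + e) sequentially"
  obtains l r where "strict_mono (r :: nat \<Rightarrow> nat)" "(p \<circ> r) \<longlonglongrightarrow> l"
    "l \<in> dom \<Gamma>" "energy \<Gamma> l \<le> c"
proof -
  have "eventually (\<lambda>n. energy {(1, 0), (0, 1)} (p n) \<le> c + 1) sequentially"
    by (rule ev) (use \<Gamma> in \<open>auto simp: has_monomers_def\<close>)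
  then obtain N where N: "\<And>n. n \<ge> N \<Longrightarrow> energy {(1, 0), (0, 1)} (p n) \<le> c + 1"
    by (auto simp: eventually_sequentially)
  have "bounded (range (\<lambda>n. p (n + N)))"
    by (rule bounded_subset[OF energy_coercive[of "c + 1"]]) (use N in auto)
  then obtain l r where r: "strict_mono r" and lim: "((\<lambda>n. p (n + N)) \<circ> r) \<longlonglongrightarrow> l"
    using bounded_imp_convergent_subsequence by blast
  define r' where "r' n = r n + N" for n
  have r': "strict_mono r'" using r by (simp add: strict_mono_def r'_def)
  have lim': "(p \<circ> r') \<longlonglongrightarrow> l" using lim by (simp add: o_def r'_def)
  \<comment> \<open>Each finite energy is continuous, so its eventual upper bound passes to the
    limit of the subsequence; then the slack tends to 0.\<close>
  have le: "energy A l \<le> c" if A: "finite A" "A \<subseteq> \<Gamma>" for A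
  proof (rule field_le_epsilon)
    fix e :: real assume "e > 0"
    from ev[OF A this] have "eventually (\<lambda>n. energy A ((p \<circ> r') n) \<le> c + e) sequentially"
      using eventually_subseq[OF r'] by simp
    moreover have "(\<lambda>n. energy A ((p \<circ> r') n)) \<longlonglongrightarrow> energy A l"
      by (rule continuous_on_tendsto_compose[OF continuous_energy_finite[OF A(1)] lim']) auto
    ultimately show "energy A l \<le> c + e"
      by (intro tendsto_upperbound) auto
  qed
  have "\<Gamma> \<subseteq> Omega" using \<Gamma> by (simp add: has_monomers_def)
  from energy_le_if_finite[OF this le] that[OF r' lim'] show thesis by blast
qed

text \<open>The direct method: a minimising sequence has a convergent subsequence, and its limit
  does not exceed the infimum.\<close>

lemma minimiser_exists:
  assumes \<Gamma>: "has_monomers \<Gamma>" and ne: "dom \<Gamma> \<noteq> {}"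
  obtains p where "minimiser \<Gamma> p"
proof -
  have sub: "\<Gamma> \<subseteq> Omega" using \<Gamma> by (simp add: has_monomers_def)
  \<comment> \<open>The monomer energy is a lower bound for the energy. It is positive off the
    compact sublevel set \<open>K\<close> and bounded on \<open>K\<close> by continuity.\<close>
  have "bdd_below (energy \<Gamma> ` dom \<Gamma>)"
  proof -
    define K where "K = {p. energy {(1, 0), (0, 1)} p \<le> 0}"
    have "closed K" unfolding K_def
      by (rule closed_Collect_le) (auto intro: continuous_energy_finite)
    then have "compact K"
      using energy_coercive[of 0] by (simp add: K_def compact_eq_bounded_closed)
    then have "bounded (energy {(1, 0), (0, 1)} ` K)"
      by (intro compact_imp_bounded compact_continuous_image)
        (auto intro: continuous_on_subset[OF continuous_energy_finite])
    then obtain b where b: "\<And>p. p \<in> K \<Longrightarrow> \<bar>energy {(1, 0), (0, 1)} p\<bar> \<le> b"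
      by (auto simp: bounded_iff)
    have "- \<bar>b\<bar> \<le> energy \<Gamma> p" if "p \<in> dom \<Gamma>" for p
    proof -
      have "- \<bar>b\<bar> \<le> energy {(1, 0), (0, 1)} p"
        using b[of p] by (cases "p \<in> K") (auto simp: K_def)
      also have "\<dots> \<le> energy \<Gamma> p"
        by (rule energy_mono_finite) (use \<Gamma> that in \<open>auto simp: has_monomers_def\<close>)
      finally show ?thesis .
    qed
    then show ?thesis by (intro bdd_belowI2)
  qed
  note bdd = this
  define m where "m = Inf (energy \<Gamma> ` dom \<Gamma>)"
  have "\<exists>p. p \<in> dom \<Gamma> \<and> energy \<Gamma> p < m + inverse (real (Suc n))" for n
    using cInf_lessD[of "energy \<Gamma> ` dom \<Gamma>" "m + inverse (real (Suc n))"] ne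
    by (auto simp: m_def)
  then obtain p where p: "\<And>n. p n \<in> dom \<Gamma>" "\<And>n. energy \<Gamma> (p n) < m + inverse (real (Suc n))"
    by metis
  obtain l where l: "l \<in> dom \<Gamma>" "energy \<Gamma> l \<le> m"
  proof (rule compactness_of_almost_minimisers[OF \<Gamma>, of p m])
    fix A and e :: real assume A: "finite A" "A \<subseteq> \<Gamma>" and e: "e > 0"
    have "eventually (\<lambda>n. inverse (real (Suc n)) < e) sequentially"
      using LIMSEQ_inverse_real_of_nat e by (rule order_tendstoD)
    then show "eventually (\<lambda>n. energy A (p n) \<le> m + e) sequentially"
    proof eventually_elim
      case (elim n)
      then show ?case
        using energy_mono_finite[OF A sub p(1)[of n]] p(2)[of n] by linarith
    qed
  qed
  have "minimiser \<Gamma> l"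
    using l cInf_lower[OF _ bdd] by (force simp: minimiser_def m_def)
  then show thesis by (rule that)
qed

section \<open>Convexity and the first variation at a minimiser\<close>

text \<open>Each density is an exponential along the segment, so it lies below its chord. Summing
  the chords gives a summable majorant.\<close>

lemma dom_convex_combination:
  assumes "\<Gamma> \<subseteq> Omega" "p \<in> dom \<Gamma>" "q \<in> dom \<Gamma>" "0 \<le> t" "t \<le> 1"
  shows "p + t *\<^sub>R (q - p) \<in> dom \<Gamma>"
    and "i \<in> Omega \<Longrightarrow> dens (p + t *\<^sub>R (q - p)) i - dens p i \<le> t * (dens q i - dens p i)"
proof -
  have le: "dens (p + t *\<^sub>R (q - p)) i - dens p i \<le> t * (dens q i - dens p i)" if "i \<in> Omega" for i
  proof -
    have "dens p i * (exp (t * (kvec i \<bullet> (q - p))) - 1) \<le> dens p i * (t * (exp (kvec i \<bullet> (q - p)) - 1))"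
      by (intro mult_left_mono exp_scaled_minus_one_le assms dens_nonneg that)
    moreover have "dens q i = dens p i * exp (kvec i \<bullet> (q - p))"
      using dens_add[of p "q - p" i] by simp
    ultimately show ?thesis by (simp add: dens_add right_diff_distrib mult.left_commute mult.commute[of t])
  qed
  then show "i \<in> Omega \<Longrightarrow> dens (p + t *\<^sub>R (q - p)) i - dens p i \<le> t * (dens q i - dens p i)" .
  have "(\<lambda>i. (1 - t) * dens p i + t * dens q i) summable_on \<Gamma>"
    using assms by (intro summable_on_add summable_on_cmult_right) (auto simp: dom_def)
  then have "dens (p + t *\<^sub>R (q - p)) summable_on \<Gamma>"
  proof (rule summable_on_comparison_test)
    fix i assume "i \<in> \<Gamma>"
    then have i: "i \<in> Omega" using assms(1) by auto
    show "dens (p + t *\<^sub>R (q - p)) i \<le> (1 - t) * dens p i + t * dens q i"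
      using le[OF i] by (simp add: left_diff_distrib right_diff_distrib)
    show "0 \<le> dens (p + t *\<^sub>R (q - p)) i" by (rule dens_nonneg[OF i])
  qed
  then show "p + t *\<^sub>R (q - p) \<in> dom \<Gamma>" by (simp add: dom_def)
qed

text \<open>The partial sums over \<open>A\<close> are differentiated at the minimiser, while convexity bounds the
  difference quotients over \<open>\<Gamma> - A\<close> uniformly. Hence no differentiation under an infinite sum.\<close>

lemma minimiser_finite_variation:
  assumes \<Gamma>: "\<Gamma> \<subseteq> Omega" and min: "minimiser \<Gamma> p" and q: "q \<in> dom \<Gamma>"
    and A: "finite A" "A \<subseteq> \<Gamma>"
  shows "\<nu> \<bullet> (q - p) \<le> (\<Sum>i\<in>A. dens p i * (kvec i \<bullet> (q - p)))
           + (\<Sum>\<^sub>\<infinity>i\<in>\<Gamma> - A. dens q i - dens p i)"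
proof -
  define d where "d = q - p"
  define S where "S = (\<Sum>\<^sub>\<infinity>i\<in>\<Gamma> - A. dens q i - dens p i)"
  \<comment> \<open>An upper bound for the difference quotient of the infinite sum: exact quotients
    on \<open>A\<close>, and on the remainder the chord bound \<open>S\<close>, which does not
    depend on t.\<close>
  define R where "R t = (\<Sum>i\<in>A. dens p i * ((exp (t * (kvec i \<bullet> d)) - 1) / t)) + S" for t
  have p: "p \<in> dom \<Gamma>" using min by (simp add: minimiser_def)
  have tail: "(\<lambda>i. g i) summable_on (\<Gamma> - A)" if "g summable_on \<Gamma>" for g :: "_ \<Rightarrow> real"
    using that by (rule summable_on_subset_banach) auto
  have le: "\<nu> \<bullet> d \<le> R t" if t: "0 < t" "t < 1" for t
  proof -
    define p' where "p' = p + t *\<^sub>R d"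
    have p': "p' \<in> dom \<Gamma>"
      and d': "\<And>i. i \<in> Omega \<Longrightarrow> dens p' i - dens p i \<le> t * (dens q i - dens p i)"
      using dom_convex_combination[OF \<Gamma> p q, of t] t by (auto simp: p'_def d_def)
    have sm: "(\<lambda>i. dens p' i - dens p i) summable_on \<Gamma>" "(\<lambda>i. dens q i - dens p i) summable_on \<Gamma>"
      using p p' q by (auto simp: dom_def intro: infsum_minus)
    have "0 \<le> energy \<Gamma> p' - energy \<Gamma> p"
      using min p' by (simp add: minimiser_def)
    also have "\<dots> = (\<Sum>\<^sub>\<infinity>i\<in>\<Gamma>. dens p' i - dens p i) - t * (\<nu> \<bullet> d)"
      using p p' infsum_minus(2)[of "dens p'" \<Gamma> "dens p"]
      by (simp add: energy_def dom_def p'_def inner_add_right)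
    also have "(\<Sum>\<^sub>\<infinity>i\<in>\<Gamma>. dens p' i - dens p i)
        = (\<Sum>i\<in>A. dens p' i - dens p i) + (\<Sum>\<^sub>\<infinity>i\<in>\<Gamma> - A. dens p' i - dens p i)"
      by (rule infsum_split_finite[OF sm(1) A])
    also have "(\<Sum>\<^sub>\<infinity>i\<in>\<Gamma> - A. dens p' i - dens p i) \<le> t * S"
    proof -
      have "(\<Sum>\<^sub>\<infinity>i\<in>\<Gamma> - A. dens p' i - dens p i) \<le> (\<Sum>\<^sub>\<infinity>i\<in>\<Gamma> - A. t * (dens q i - dens p i))"
        by (rule infsum_mono) (use tail[OF sm(1)] tail[OF sm(2)] d' \<Gamma> in
            \<open>auto intro!: summable_on_cmult_right\<close>)
      also have "\<dots> = t * S"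
        by (simp add: infsum_cmult_right' S_def)
      finally show ?thesis .
    qed
    finally have "t * (\<nu> \<bullet> d) \<le> (\<Sum>i\<in>A. dens p' i - dens p i) + t * S" by simp
    also have "(\<Sum>i\<in>A. dens p' i - dens p i) = t * (\<Sum>i\<in>A. dens p i * ((exp (t * (kvec i \<bullet> d)) - 1) / t))"
      using t unfolding sum_distrib_left by (intro sum.cong) (simp_all add: p'_def dens_add field_simps)
    finally have "t * (\<nu> \<bullet> d) \<le> t * R t" by (simp add: R_def distrib_left)
    then show ?thesis using t by simp
  qed
  have lim: "((\<lambda>t. (exp (t * c) - 1) / t) \<longlongrightarrow> c) (at_right 0)" for c :: real
  proof -
    have "((\<lambda>t. exp (t * c)) has_real_derivative c) (at 0)"
      by (auto intro!: derivative_eq_intros)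
    then have "((\<lambda>t. (exp (t * c) - 1) / t) \<longlongrightarrow> c) (at 0)"
      by (simp add: has_field_derivative_iff)
    then show ?thesis by (rule filterlim_at_split[THEN iffD1, THEN conjunct2])
  qed
  have "(R \<longlongrightarrow> (\<Sum>i\<in>A. dens p i * (kvec i \<bullet> d)) + S) (at_right 0)"
    unfolding R_def by (intro tendsto_intros lim)
  moreover have "eventually (\<lambda>t. \<nu> \<bullet> d \<le> R t) (at_right 0)"
    using eventually_at_right_less[of 0] eventually_at_right_real[of 0 1]
    by (auto elim!: eventually_mono intro: le)
  ultimately show ?thesis
    unfolding d_def[symmetric] S_def[symmetric] by (intro tendsto_lowerbound) auto
qed

section \<open>Finite masses and the gradient\<close>

text \<open>Both r and s are at most r + s, and r + s is at least 1 on \<open>Omega\<close>; so the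
  total mass dominates each single mass and the density sum.\<close>

lemma mass_dom_summable:
  assumes "\<Gamma> \<subseteq> Omega" "p \<in> mass_dom \<Gamma>"
  shows "(\<lambda>i. dens p i * real (fst i)) summable_on \<Gamma>"
    and "(\<lambda>i. dens p i * real (snd i)) summable_on \<Gamma>"
    and "(\<lambda>i. dens p i * (kvec i \<bullet> d)) summable_on \<Gamma>"
    and "p \<in> dom \<Gamma>"
proof -
  note s = assms(2)[unfolded mass_dom_def mem_Collect_eq]
  note nn = dens_nonneg[OF subsetD[OF assms(1)]]
  show 1: "(\<lambda>i. dens p i * real (fst i)) summable_on \<Gamma>"
    by (rule summable_on_comparison_test[OF s]) (auto intro!: mult_left_mono nn mult_nonneg_nonneg simp: inner_kvec)
  show 2: "(\<lambda>i. dens p i * real (snd i)) summable_on \<Gamma>"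
    by (rule summable_on_comparison_test[OF s]) (auto intro!: mult_left_mono nn mult_nonneg_nonneg simp: inner_kvec)
  show "(\<lambda>i. dens p i * (kvec i \<bullet> d)) summable_on \<Gamma>"
    using summable_on_add[OF summable_on_cmult_left[OF 1, of "fst d"] summable_on_cmult_left[OF 2, of "snd d"]]
    by (simp add: inner_kvec algebra_simps)
  have "dens p i \<le> dens p i * (kvec i \<bullet> (1, 1))" if "i \<in> \<Gamma>" for i
  proof -
    have "1 \<le> fst i + snd i" using assms(1) that by (auto simp: Omega_def)
    then have "1 \<le> kvec i \<bullet> (1, 1)" by (simp add: inner_kvec)
    then show ?thesis using mult_left_mono[OF _ nn[OF that], of 1] by simp
  qed
  then have "dens p summable_on \<Gamma>"
    by (intro summable_on_comparison_test[OF s]) (auto intro: nn)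
  then show "p \<in> dom \<Gamma>" by (simp add: dom_def)
qed

lemma grad_split:
  assumes "\<Gamma> \<subseteq> Omega" "p \<in> mass_dom \<Gamma>"
  shows "grad \<Gamma> p d = fst d * (\<Sum>\<^sub>\<infinity>i\<in>\<Gamma>. dens p i * real (fst i))
           + snd d * (\<Sum>\<^sub>\<infinity>i\<in>\<Gamma>. dens p i * real (snd i))"
proof -
  have "grad \<Gamma> p d = (\<Sum>\<^sub>\<infinity>i\<in>\<Gamma>. fst d * (dens p i * real (fst i)) + snd d * (dens p i * real (snd i)))"
    by (simp add: grad_def inner_kvec algebra_simps)
  also have "\<dots> = (\<Sum>\<^sub>\<infinity>i\<in>\<Gamma>. fst d * (dens p i * real (fst i))) + (\<Sum>\<^sub>\<infinity>i\<in>\<Gamma>. snd d * (dens p i * real (snd i)))"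
    by (intro infsum_add summable_on_cmult_right mass_dom_summable[OF assms])
  finally show ?thesis by (simp add: infsum_cmult_right')
qed

text \<open>Every density decreases in the direction (-1, -1), so the first variation bounds each
  partial sum of the total mass by the sum of the two prescribed masses.\<close>

lemma minimiser_in_mass_dom:
  assumes \<Gamma>: "\<Gamma> \<subseteq> Omega" and min: "minimiser \<Gamma> p"
  shows "p \<in> mass_dom \<Gamma>"
proof -
  define q where "q = p - (1, 1)"
  have le: "dens q i \<le> dens p i" if "i \<in> Omega" for i
  proof -
    have "dens p i * exp (kvec i \<bullet> (- (1, 1))) \<le> dens p i * 1"
      by (intro mult_left_mono dens_nonneg that) (simp add: inner_kvec)
    then show ?thesis using dens_add[of p "- (1, 1)" i]
      unfolding q_def diff_conv_add_uminus by simp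
  qed
  have p: "dens p summable_on \<Gamma>" using min by (simp add: minimiser_def dom_def)
  have q: "q \<in> dom \<Gamma>" unfolding dom_def mem_Collect_eq
    by (rule summable_on_comparison_test[OF p]) (use \<Gamma> in \<open>auto intro!: le dens_nonneg\<close>)
  have "(\<Sum>i\<in>A. dens p i * (kvec i \<bullet> (1, 1))) \<le> \<nu> \<bullet> (1, 1)" if A: "finite A" "A \<subseteq> \<Gamma>" for A
  proof -
    have "(\<Sum>\<^sub>\<infinity>i\<in>\<Gamma> - A. dens q i - dens p i) \<le> 0"
    proof -
      have "0 \<le> (\<Sum>\<^sub>\<infinity>i\<in>\<Gamma> - A. - (dens q i - dens p i))"
        by (rule infsum_nonneg) (use \<Gamma> le in force)
      then show ?thesis unfolding infsum_uminus by simp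
    qed
    moreover have "q - p = - (1, 1)" by (simp add: q_def)
    ultimately show ?thesis
      using minimiser_finite_variation[OF \<Gamma> min q A]
      by (simp add: sum_negf del: uminus_Pair)
  qed
  then have "bdd_above (sum (\<lambda>i. dens p i * (kvec i \<bullet> (1, 1))) ` {F. F \<subseteq> \<Gamma> \<and> finite F})"
    by (intro bdd_aboveI2) auto
  moreover have "dens p i * (kvec i \<bullet> (1, 1)) \<ge> 0" if "i \<in> \<Gamma>" for i
    using \<Gamma> that dens_nonneg[of i p] by (auto simp: inner_kvec)
  ultimately show ?thesis
    unfolding mass_dom_def mem_Collect_eq by (intro nonneg_bdd_above_summable_on)
qed

section \<open>The variational inequality and its unique solution\<close>

text \<open>Test points range over \<open>mass_dom\<close>, the logarithmic counterpart of the
  existence region, and not over all of \<open>dom\<close>.\<close>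

definition variational :: "(nat \<times> nat) set \<Rightarrow> real \<times> real \<Rightarrow> bool" where
  "variational \<Gamma> p \<longleftrightarrow> p \<in> mass_dom \<Gamma> \<and> (\<forall>q\<in>mass_dom \<Gamma>. \<nu> \<bullet> (q - p) \<le> grad \<Gamma> p (q - p))"

text \<open>Let the finite set A exhaust \<Gamma> in \<open>minimiser_finite_variation\<close>: the
  finite sums tend to \<open>grad\<close>, and the remainders tend to 0.\<close>

lemma minimiser_variational:
  assumes \<Gamma>: "\<Gamma> \<subseteq> Omega" and min: "minimiser \<Gamma> p"
  shows "variational \<Gamma> p"
proof -
  have p: "p \<in> mass_dom \<Gamma>" by (rule minimiser_in_mass_dom[OF assms])
  have "\<nu> \<bullet> (q - p) \<le> grad \<Gamma> p (q - p)" if q: "q \<in> mass_dom \<Gamma>" for q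
  proof -
    let ?g = "\<lambda>i. dens p i * (kvec i \<bullet> (q - p))" and ?h = "\<lambda>i. dens q i - dens p i"
    have g: "?g summable_on \<Gamma>" by (rule mass_dom_summable[OF \<Gamma> p])
    have h: "?h summable_on \<Gamma>"
      using mass_dom_summable(4)[OF \<Gamma> p] mass_dom_summable(4)[OF \<Gamma> q]
      by (auto simp: dom_def intro: infsum_minus)
    have "eventually (\<lambda>A. \<nu> \<bullet> (q - p) \<le> sum ?g A + (infsum ?h \<Gamma> - sum ?h A)) (finite_subsets_at_top \<Gamma>)"
    proof (rule eventually_finite_subsets_at_top_weakI)
      fix A assume A: "finite A" "A \<subseteq> \<Gamma>"
      have "infsum ?h (\<Gamma> - A) = infsum ?h \<Gamma> - sum ?h A"
        using infsum_split_finite[OF h A] by simp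
      then show "\<nu> \<bullet> (q - p) \<le> sum ?g A + (infsum ?h \<Gamma> - sum ?h A)"
        using minimiser_finite_variation[OF \<Gamma> min mass_dom_summable(4)[OF \<Gamma> q] A] by simp
    qed
    moreover have "((\<lambda>A. sum ?g A + (infsum ?h \<Gamma> - sum ?h A)) \<longlongrightarrow>
        infsum ?g \<Gamma> + (infsum ?h \<Gamma> - infsum ?h \<Gamma>)) (finite_subsets_at_top \<Gamma>)"
      by (intro tendsto_intros infsum_tendsto g h)
    ultimately show ?thesis
      using tendsto_lowerbound by (fastforce simp: grad_def)
  qed
  with p show ?thesis by (simp add: variational_def)
qed

text \<open>Termwise comparison with c = \<open>kvec i \<bullet> (q - p)\<close>: since exp c - 1
  and c have the same sign, c \<le> exp c * c, strictly unless c = 0.\<close>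

lemma grad_strictly_monotone:
  assumes \<Gamma>: "has_monomers \<Gamma>" and p: "p \<in> mass_dom \<Gamma>" and q: "q \<in> mass_dom \<Gamma>" and ne: "p \<noteq> q"
  shows "grad \<Gamma> p (q - p) < grad \<Gamma> q (q - p)"
proof -
  have sub: "\<Gamma> \<subseteq> Omega" using \<Gamma> by (simp add: has_monomers_def)
  have eq: "dens q i = dens p i * exp (kvec i \<bullet> (q - p))" for i
    using dens_add[of p "q - p" i] by simp
  have le: "c \<le> exp c * c" for c :: real
    by (cases "c \<ge> 0") (simp_all add: mult_le_cancel_right1 mult_le_cancel_right2)
  have less: "c < exp c * c" if "c \<noteq> 0" for c :: real
    using that by (cases "c \<ge> 0") (simp_all add: mult_less_cancel_right1 mult_less_cancel_right2)
  \<comment> \<open>The monomer exponents are the unit vectors, so one of them detects any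
    difference between p and q.\<close>
  obtain j where j: "j \<in> \<Gamma>" "kvec j \<bullet> (q - p) \<noteq> 0"
  proof (cases "fst p = fst q")
    case True
    then have "snd p \<noteq> snd q" using ne by (simp add: prod_eq_iff)
    then show thesis using that[of "(0, 1)"] \<Gamma> by (simp add: inner_kvec has_monomers_def)
  next
    case False
    then show thesis using that[of "(1, 0)"] \<Gamma> by (simp add: inner_kvec has_monomers_def)
  qed
  show ?thesis unfolding grad_def
  proof (rule has_sum_strict_mono[OF has_sum_infsum has_sum_infsum])
    show "j \<in> \<Gamma>" by fact
    show "dens p j * (kvec j \<bullet> (q - p)) < dens q j * (kvec j \<bullet> (q - p))"
      unfolding eq mult.assoc using j less dens_pos[of j p] sub by (intro mult_strict_left_mono) auto
    show "dens p i * (kvec i \<bullet> (q - p)) \<le> dens q i * (kvec i \<bullet> (q - p))" if "i \<in> \<Gamma>" for i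
      unfolding eq mult.assoc using that sub by (intro mult_left_mono le dens_nonneg) auto
  qed (intro mass_dom_summable[OF sub] p q)+
qed

text \<open>Testing each solution against the other gives two inequalities that together contradict
  strict monotonicity of the gradient.\<close>

lemma variational_unique:
  assumes \<Gamma>: "has_monomers \<Gamma>" and p: "variational \<Gamma> p" and q: "variational \<Gamma> q"
  shows "p = q"
proof (rule ccontr)
  assume ne: "p \<noteq> q"
  have sub: "\<Gamma> \<subseteq> Omega" using \<Gamma> by (simp add: has_monomers_def)
  have "\<nu> \<bullet> (q - p) \<le> grad \<Gamma> p (q - p)" using p q by (simp add: variational_def)
  also have "\<dots> < grad \<Gamma> q (q - p)"
    by (rule grad_strictly_monotone[OF \<Gamma> _ _ ne]) (use p q in \<open>auto simp: variational_def\<close>)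
  also have "\<dots> = - grad \<Gamma> q (p - q)"
    using q by (simp add: grad_split[OF sub] variational_def algebra_simps)
  also have "\<dots> \<le> - (\<nu> \<bullet> (p - q))" using p q by (simp add: variational_def)
  finally show False by (simp add: inner_diff_right)
qed

text \<open>A minimiser exists and solves the inequality; by uniqueness every solution coincides
  with it.\<close>

lemma variational_iff_minimiser:
  assumes \<Gamma>: "has_monomers \<Gamma>" and ne: "dom \<Gamma> \<noteq> {}"
  shows "variational \<Gamma> p \<longleftrightarrow> minimiser \<Gamma> p"
  using minimiser_exists[OF assms] minimiser_variational variational_unique[OF \<Gamma>] \<Gamma>
  by (metis has_monomers_def)

section \<open>Convergence of the truncated minimisers\<close>

text \<open>A subsequence that stays away from l would, by compactness, have a limit point with
  energy at most that of l, hence another minimiser.\<close>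

lemma minimisers_converge:
  assumes \<Gamma>: "\<And>n. finite (\<Gamma> n)" "\<And>n. has_monomers (\<Gamma> n)" and lim: "tends_to_Omega \<Gamma>"
    and p: "\<And>n. minimiser (\<Gamma> n) (p n)" and l: "minimiser Omega l"
  shows "p \<longlonglongrightarrow> l"
proof (rule ccontr)
  assume "\<not> p \<longlonglongrightarrow> l"
  then obtain e where e: "e > 0" and "\<not> (\<exists>N. \<forall>n\<ge>N. dist (p n) l < e)"
    by (auto simp: lim_sequentially)
  then have "\<exists>\<^sub>\<infinity>n. dist (p n) l \<ge> e"
    by (auto simp: INFM_nat_le not_less)
  then have "infinite {n. dist (p n) l \<ge> e}"
    by (simp add: frequently_cofinite)
  then obtain r :: "nat \<Rightarrow> nat" where r: "strict_mono r" "\<And>n. dist (p (r n)) l \<ge> e"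
    using infinite_enumerate by blast
  have U: "has_monomers Omega" by (auto simp: has_monomers_def Omega_def)
  have ld: "l \<in> dom Omega" using l by (simp add: minimiser_def)
  obtain l' s where s: "strict_mono s" "((p \<circ> r) \<circ> s) \<longlonglongrightarrow> l'"
    and l': "l' \<in> dom Omega" "energy Omega l' \<le> energy Omega l"
  proof (rule compactness_of_almost_minimisers[OF U, of "p \<circ> r" "energy Omega l"])
    fix A and d :: real assume A: "finite A" "A \<subseteq> Omega" and d: "d > 0"
    \<comment> \<open>Convergence to \<open>Omega\<close> is pointwise, but a finite set A is
      eventually contained in the truncations. From then on the energy of A lies below the truncated
      energy.\<close>
    have "eventually (\<lambda>n. \<forall>i\<in>A. i \<in> \<Gamma> n) sequentially"
      using A lim by (intro eventually_ball_finite)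
        (auto simp: tends_to_Omega_def eventually_sequentially)
    then have "eventually (\<lambda>n. energy A (p n) \<le> energy Omega l) sequentially"
    proof eventually_elim
      case (elim n)
      have n: "p n \<in> dom (\<Gamma> n)" "l \<in> dom (\<Gamma> n)" "\<Gamma> n \<subseteq> Omega"
        using \<Gamma>[of n] by (auto simp: dom_finite has_monomers_def)
      have "energy A (p n) \<le> energy (\<Gamma> n) (p n)"
        by (rule energy_mono_finite) (use A elim n in auto)
      also have "\<dots> \<le> energy (\<Gamma> n) l" using p[of n] n by (simp add: minimiser_def)
      also have "\<dots> \<le> energy Omega l"
        by (rule energy_mono_finite) (use \<Gamma> n ld in auto)
      finally show ?case .
    qed
    then show "eventually (\<lambda>n. energy A ((p \<circ> r) n) \<le> energy Omega l + d) sequentially"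
      by (rule eventually_subseq[OF r(1), THEN eventually_mono]) (use d in simp)
  qed
  have "minimiser Omega l'" using l l' by (force simp: minimiser_def)
  then have "l' = l"
    using l variational_iff_minimiser[OF U] variational_unique[OF U] ld by blast
  with s(2) have "eventually (\<lambda>n. dist (p (r (s n))) l < e) sequentially"
    using e by (auto simp: o_def dest: tendstoD)
  with r(2) show False by (auto simp: eventually_sequentially not_less[symmetric])
qed

section \<open>Return to the variables z and w\<close>

lemma cbar_eq_dens: "z > 0 \<Longrightarrow> w > 0 \<Longrightarrow> cbar Q z w = dens (ln z, ln w)"
  by (rule ext) (simp add: cbar_def case_prod_beta dens_def inner_kvec exp_add exp_of_nat_mult)

lemma mass_dom_iff:
  assumes "\<Gamma> \<subseteq> Omega"
  shows "p \<in> mass_dom \<Gamma> \<longleftrightarrow> (\<lambda>i. dens p i * real (fst i)) summable_on \<Gamma> \<and>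
    (\<lambda>i. dens p i * real (snd i)) summable_on \<Gamma>"
proof
  assume "(\<lambda>i. dens p i * real (fst i)) summable_on \<Gamma> \<and>
    (\<lambda>i. dens p i * real (snd i)) summable_on \<Gamma>"
  then have "(\<lambda>i. dens p i * real (fst i) + dens p i * real (snd i)) summable_on \<Gamma>"
    by (auto intro: summable_on_add)
  then show "p \<in> mass_dom \<Gamma>"
    by (simp add: mass_dom_def inner_kvec distrib_left)
qed (blast intro: mass_dom_summable(1,2)[OF assms])

lemma existence_region_iff_mass_dom:
  assumes "z > 0" "w > 0"
  shows "(z, w) \<in> existence_region Q \<longleftrightarrow> (ln z, ln w) \<in> mass_dom Omega"
  using existence_region_iff(1)[OF Q_pos assms]
  by (simp add: mass_dom_iff cbar_eq_dens assms)

text \<open>The substitution q = (ln u, ln v) turns one inequality into the other, and exp makes it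
  reach every q in the plane.\<close>

lemma variational_pair_iff:
  "variational_pair Q (fst \<nu>) (snd \<nu>) z w \<longleftrightarrow> z > 0 \<and> w > 0 \<and> variational Omega (ln z, ln w)"
proof (cases "z > 0 \<and> w > 0 \<and> (ln z, ln w) \<in> mass_dom Omega")
  case False
  then show ?thesis
    using existence_region_iff_mass_dom[of z w] by (auto simp: variational_pair_def variational_def)
next
  case True
  then have zw: "z > 0" "w > 0" and p: "(ln z, ln w) \<in> mass_dom Omega" by auto
  define R where "R = enn2real (rho (cbar Q z w))"
  define S where "S = enn2real (sigma (cbar Q z w))"
  have RS: "grad Omega (ln z, ln w) d = fst d * R + snd d * S" for d
    using existence_region_iff(2,3)[of Q, OF _ zw] Q_pos p
    by (simp add: R_def S_def grad_split[OF order_refl p] mass_dom_iff cbar_eq_dens zw)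
  \<comment> \<open>ln (z / u) and ln (w / v) are the negated coordinates of q - p, which accounts
    for the reversed inequality.\<close>
  have ineq: "ln (z / u) * (fst \<nu> - R) + ln (w / v) * (snd \<nu> - S) \<ge> 0 \<longleftrightarrow>
      \<nu> \<bullet> ((ln u, ln v) - (ln z, ln w)) \<le> grad Omega (ln z, ln w) ((ln u, ln v) - (ln z, ln w))"
    if "u > 0" "v > 0" for u v
    using zw that by (simp add: RS ln_div inner_prod_def algebra_simps)
  have "variational_pair Q (fst \<nu>) (snd \<nu>) z w \<longleftrightarrow> (\<forall>u v. u > 0 \<and> v > 0 \<and> (ln u, ln v) \<in> mass_dom Omega \<longrightarrow>
      \<nu> \<bullet> ((ln u, ln v) - (ln z, ln w)) \<le> grad Omega (ln z, ln w) ((ln u, ln v) - (ln z, ln w)))"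
    unfolding variational_pair_def R_def[symmetric] S_def[symmetric]
    using zw p by (auto simp: existence_region_iff_mass_dom ineq simp del: diff_Pair)
  also have "\<dots> \<longleftrightarrow> (\<forall>q\<in>mass_dom Omega. \<nu> \<bullet> (q - (ln z, ln w)) \<le> grad Omega (ln z, ln w) (q - (ln z, ln w)))"
    (is "?L \<longleftrightarrow> ?R")
  proof
    assume L: ?L
    show ?R
    proof
      fix q assume "q \<in> mass_dom Omega"
      then show "\<nu> \<bullet> (q - (ln z, ln w)) \<le> grad Omega (ln z, ln w) (q - (ln z, ln w))"
        using L[rule_format, of "exp (fst q)" "exp (snd q)"] by simp
    qed
  qed blast
  finally show ?thesis using zw p by (simp add: variational_def)
qed

section \<open>Truncations and the pairs they determine\<close>

text \<open>For finite sums every direction is allowed together with its opposite, so the linear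
  inequality becomes an equality.\<close>

lemma variational_finite_iff:
  assumes fin: "finite \<Gamma>" and \<Gamma>: "has_monomers \<Gamma>"
  shows "variational \<Gamma> p \<longleftrightarrow> (\<Sum>i\<in>\<Gamma>. dens p i * real (fst i)) = fst \<nu> \<and>
    (\<Sum>i\<in>\<Gamma>. dens p i * real (snd i)) = snd \<nu>" (is "_ \<longleftrightarrow> ?r = _ \<and> ?s = _")
proof -
  have sub: "\<Gamma> \<subseteq> Omega" using \<Gamma> by (simp add: has_monomers_def)
  have UN: "mass_dom \<Gamma> = UNIV" using fin by (simp add: mass_dom_def)
  have g: "grad \<Gamma> p d = fst d * ?r + snd d * ?s" for d
    using grad_split[OF sub, of p d] UN fin by simp
  show ?thesis
  proof
    assume v: "variational \<Gamma> p"
    have d: "\<nu> \<bullet> d \<le> grad \<Gamma> p d" for d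
    proof -
      have "p + d \<in> mass_dom \<Gamma>" by (simp add: UN)
      then have "\<nu> \<bullet> (p + d - p) \<le> grad \<Gamma> p (p + d - p)" using v unfolding variational_def by blast
      then show ?thesis by simp
    qed
    show "?r = fst \<nu> \<and> ?s = snd \<nu>"
      using d[of "(1, 0)"] d[of "(-1, 0)"] d[of "(0, 1)"] d[of "(0, -1)"]
      by (simp add: g inner_prod_def)
  next
    assume "?r = fst \<nu> \<and> ?s = snd \<nu>"
    then show "variational \<Gamma> p"
      by (simp add: variational_def UN g inner_prod_def)
  qed
qed

text \<open>Shows that the definite description in \<open>truncated_pair\<close> has exactly one
  solution and identifies it through the truncated energy.\<close>

lemma truncated_pair_minimiser:
  assumes adm: "admissible \<Gamma>"
  obtains p where "minimiser \<Gamma> p"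
    "truncated_pair Q (fst \<nu>) (snd \<nu>) \<Gamma> = (exp (fst p), exp (snd p))"
proof -
  have fin: "finite \<Gamma>" and \<Gamma>: "has_monomers \<Gamma>" using adm by (auto simp: admissible_def has_monomers_def)
  have sub: "\<Gamma> \<subseteq> Omega" using \<Gamma> by (simp add: has_monomers_def)
  obtain p where p: "minimiser \<Gamma> p"
    using minimiser_exists[OF \<Gamma>] fin by (auto simp: dom_finite)
  let ?M = "\<lambda>z w. z \<ge> 0 \<and> w \<ge> 0 \<and>
     (\<Sum>(r, s)\<in>\<Gamma>. real r * z ^ r * w ^ s * Q (r, s)) = fst \<nu> \<and>
     (\<Sum>(r, s)\<in>\<Gamma>. real s * z ^ r * w ^ s * Q (r, s)) = snd \<nu>"
  have M: "?M z w \<longleftrightarrow> z > 0 \<and> w > 0 \<and> variational \<Gamma> (ln z, ln w)" for z w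
  proof (cases "z > 0 \<and> w > 0")
    case True
    have "(\<Sum>(r, s)\<in>\<Gamma>. real r * z ^ r * w ^ s * Q (r, s)) = (\<Sum>i\<in>\<Gamma>. cbar Q z w i * real (fst i))"
      "(\<Sum>(r, s)\<in>\<Gamma>. real s * z ^ r * w ^ s * Q (r, s)) = (\<Sum>i\<in>\<Gamma>. cbar Q z w i * real (snd i))"
      by (auto simp: cbar_def case_prod_beta intro!: sum.cong)
    with True show ?thesis
      by (simp add: variational_finite_iff[OF fin \<Gamma>] cbar_eq_dens)
  next
    \<comment> \<open>A pair with a zero component is excluded because its corresponding mass
      vanishes: r * 0 ^ r = 0 for every r, with the factor r covering the case 0 ^ 0 = 1.\<close>
    case False
    have "\<not> ?M z w"
    proof
      assume m: "?M z w"
      then consider "z = 0" | "w = 0" using False by linarith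
      then show False
      proof cases
        case 1
        then have "(\<Sum>(r, s)\<in>\<Gamma>. real r * z ^ r * w ^ s * Q (r, s)) = 0"
          by (intro sum.neutral) (auto simp: power_0_left)
        then show False using m \<nu>_pos by simp
      next
        case 2
        then have "(\<Sum>(r, s)\<in>\<Gamma>. real s * z ^ r * w ^ s * Q (r, s)) = 0"
          by (intro sum.neutral) (auto simp: power_0_left)
        then show False using m \<nu>_pos by simp
      qed
    qed
    then show ?thesis using False by blast
  qed
  have v: "variational \<Gamma> p" by (rule minimiser_variational[OF sub p])
  have "truncated_pair Q (fst \<nu>) (snd \<nu>) \<Gamma> = (exp (fst p), exp (snd p))"
    unfolding truncated_pair_def M
  proof (rule the_equality)
    show "case (exp (fst p), exp (snd p)) of (z, w) \<Rightarrow> z > 0 \<and> w > 0 \<and> variational \<Gamma> (ln z, ln w)"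
      using v by simp
    fix x assume "case x of (z, w) \<Rightarrow> z > 0 \<and> w > 0 \<and> variational \<Gamma> (ln z, ln w)"
    then show "x = (exp (fst p), exp (snd p))"
      using variational_unique[OF \<Gamma> v] by (cases x) auto
  qed
  with p show thesis by (rule that)
qed

end

section \<open>Existence, uniqueness and convergence in the original variables\<close>

theorem theorem3p7:
  fixes Q :: "nat \<times> nat \<Rightarrow> real" and \<rho>\<^sub>0 \<sigma>\<^sub>0 :: real
  assumes "\<And>p. p \<in> Omega \<Longrightarrow> Q p > 0"
    and "Q (1, 0) = 1" and "Q (0, 1) = 1"
    and "\<exists>u v. u > 0 \<and> v > 0 \<and> (u, v) \<in> existence_region Q"
    and "\<rho>\<^sub>0 > 0" and "\<sigma>\<^sub>0 > 0"
  shows "(\<exists>!(z, w). variational_pair Q \<rho>\<^sub>0 \<sigma>\<^sub>0 z w) \<and>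
    (\<forall>z w. variational_pair Q \<rho>\<^sub>0 \<sigma>\<^sub>0 z w \<longrightarrow>
      (\<forall>\<Gamma>. (\<forall>n. admissible (\<Gamma> n)) \<and> tends_to_Omega \<Gamma> \<longrightarrow>
        (\<lambda>n. fst (truncated_pair Q \<rho>\<^sub>0 \<sigma>\<^sub>0 (\<Gamma> n))) \<longlonglongrightarrow> z \<and>
        (\<lambda>n. snd (truncated_pair Q \<rho>\<^sub>0 \<sigma>\<^sub>0 (\<Gamma> n))) \<longlonglongrightarrow> w))"
proof -
  interpret cluster_weights Q "(\<rho>\<^sub>0, \<sigma>\<^sub>0)"
    by unfold_locales (use assms in auto)
  have U: "has_monomers Omega" by (auto simp: has_monomers_def Omega_def)
  obtain u v where "u > 0" "v > 0" "(u, v) \<in> existence_region Q" using assms(4) by blast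
  \<comment> \<open>The assumed positive point of the existence region makes the energy finite
    somewhere.\<close>
  then have "(ln u, ln v) \<in> dom Omega"
    using existence_region_iff_mass_dom mass_dom_summable(4) by blast
  then have ne: "dom Omega \<noteq> {}" by auto
  obtain p where p: "minimiser Omega p" by (rule minimiser_exists[OF U ne])
  then have v: "variational Omega p" by (simp add: variational_iff_minimiser[OF U ne])
  \<comment> \<open>Every solution is this one explicit pair, so uniqueness is immediate and
    convergence has to be shown for this limit only.\<close>
  have vp: "variational_pair Q \<rho>\<^sub>0 \<sigma>\<^sub>0 z w \<longleftrightarrow> z = exp (fst p) \<and> w = exp (snd p)" for z w
  proof
    assume "variational_pair Q \<rho>\<^sub>0 \<sigma>\<^sub>0 z w"
    then have "z > 0" "w > 0" "variational Omega (ln z, ln w)"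
      using variational_pair_iff[of z w] by auto
    then show "z = exp (fst p) \<and> w = exp (snd p)"
      using variational_unique[OF U v] by auto
  next
    assume "z = exp (fst p) \<and> w = exp (snd p)"
    then show "variational_pair Q \<rho>\<^sub>0 \<sigma>\<^sub>0 z w"
      using variational_pair_iff[of z w] v by simp
  qed
  have "(\<lambda>n. fst (truncated_pair Q \<rho>\<^sub>0 \<sigma>\<^sub>0 (\<Gamma> n))) \<longlonglongrightarrow> exp (fst p) \<and>
      (\<lambda>n. snd (truncated_pair Q \<rho>\<^sub>0 \<sigma>\<^sub>0 (\<Gamma> n))) \<longlonglongrightarrow> exp (snd p)"
    if adm: "\<And>n. admissible (\<Gamma> n)" and lim: "tends_to_Omega \<Gamma>" for \<Gamma>
  proof -
    have "\<exists>q. minimiser (\<Gamma> n) q \<and> truncated_pair Q \<rho>\<^sub>0 \<sigma>\<^sub>0 (\<Gamma> n) = (exp (fst q), exp (snd q))" for n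
      using truncated_pair_minimiser[OF adm[of n]] by (metis fst_conv snd_conv)
    then obtain q where q: "\<And>n. minimiser (\<Gamma> n) (q n)"
      "\<And>n. truncated_pair Q \<rho>\<^sub>0 \<sigma>\<^sub>0 (\<Gamma> n) = (exp (fst (q n)), exp (snd (q n)))"
      by metis
    have "q \<longlonglongrightarrow> p"
      by (rule minimisers_converge[OF _ _ lim q(1) p]) (use adm in \<open>auto simp: admissible_def has_monomers_def\<close>)
    then show ?thesis by (auto simp: q(2) intro!: tendsto_intros)
  qed
  then show ?thesis by (auto simp: vp)
qed

end
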